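(* For any $x>0$ such that $0<F(x)<1$, we have the convergence in distribution $$n^{1/2}\big(\hat F_{n,b}^{\mathrm{Gam}}(x)-\mathbb{E}[\hat F_{n,b}^{\mathrm{Gam}}(x)]\big)\xrightarrow{\ \mathscr D\ }\mathcal N(0,\sigma^2(x)),\quad\text{as } b\to0,\ n\to\infty,$$ where $\sigma^2(x):=F(x)(1-F(x))$. In particular, $$n^{1/2}\big(\hat F_{n,b}^{\mathrm{Gam}}(x)-F(x)\big)\xrightarrow{\ \mathscr D\ }\mathcal N(0,\sigma^2(x)),\quad\text{if } n^{1/2}b\to0,$$ $$n^{1/2}\big(\hat F_{n,b}^{\mathrm{Gam}}(x)-F(x)\big)\xrightarrow{\ \mathscr D\ }\mathcal N\big(\lambda\cdot(f(x)+\tfrac{x}{2}f'(x)),\sigma^2(x)\big),\quad\text{if } n^{1/2}b\to\lambda,$$ for any constant $\lambda>0$.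
   Context: $F$ is a cumulative distribution function supported on $[0,\infty)$ having two continuous and bounded derivatives; $f=F'$. $X_1,X_2,\dots$ are i.i.d. with c.d.f. $F$. The smoothing parameter $b=b_n>0$ satisfies $b\to0$ as $n\to\infty$. The Gamma kernel c.d.f. estimator is $$\hat F_{n,b}^{\mathrm{Gam}}(x):=\frac1n\sum_{i=1}^n\overline K_{\mathrm{Gam}}(X_i\mid b^{-1}x+1,\,b),\qquad \overline K_{\mathrm{Gam}}(t\mid\alpha,\theta):=\frac{\Gamma(\alpha,t/\theta)}{\Gamma(\alpha)},\quad \alpha,\theta>0,$$ where $\Gamma(\alpha,z):=\int_z^\infty t^{\alpha-1}e^{-t}\,dt$ and $\Gamma(\alpha):=\Gamma(\alpha,0)$. $\mathcal N(m,s^2)$ is the normal distribution with mean $m$ and variance $s^2$; $\xrightarrow{\mathscr D}$ denotes convergence in law. *)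

theory Defs
  imports "HOL-Probability.Probability"
begin

definition upper_Gamma :: "real \<Rightarrow> real \<Rightarrow> real" where
  "upper_Gamma \<alpha> z = (LBINT t:{z..}. t powr (\<alpha> - 1) * exp (- t))"

text \<open>The complete Gamma function, introduced in the source as the upper incomplete one at 0,
  is the library's \<^const>\<open>Gamma\<close>.\<close>

lemma upper_Gamma_0:
  assumes "\<alpha> > 0"
  shows "upper_Gamma \<alpha> 0 = Gamma \<alpha>"
proof -
  let ?f = "\<lambda>t::real. t powr (\<alpha> - 1) * exp (- t)"
  have hi: "(?f has_integral Gamma \<alpha>) {0..}"
    using Gamma_integral_real[OF assms] by (simp add: exp_minus field_simps)
  have "?f absolutely_integrable_on {0..}"
    by (rule nonnegative_absolutely_integrable_1) (use hi in auto)
  then have "set_integrable lborel {0..} ?f"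
    unfolding set_integrable_def
    by (subst (asm) integrable_completion) (auto intro!: borel_measurable_scaleR)
  from set_borel_integral_eq_integral(2)[OF this] hi show ?thesis
    unfolding upper_Gamma_def by (simp add: integral_unique)
qed

text \<open>For \<open>\<alpha>, \<theta> > 0\<close> and \<open>t \<ge> 0\<close> this is the survival function at \<open>t\<close> of the Gamma law with
  shape \<open>\<alpha>\<close> and scale \<open>\<theta>\<close>.\<close>

definition K_Gam_bar :: "real \<Rightarrow> real \<Rightarrow> real \<Rightarrow> real" where
  "K_Gam_bar t \<alpha> \<theta> = upper_Gamma \<alpha> (t / \<theta>) / Gamma \<alpha>"

text \<open>The sample is indexed from 0, so the first \<open>n\<close> observations are \<open>X i\<close> with \<open>i < n\<close>.\<close>

definition F_hat_Gam :: "(nat \<Rightarrow> 'a \<Rightarrow> real) \<Rightarrow> nat \<Rightarrow> real \<Rightarrow> real \<Rightarrow> 'a \<Rightarrow> real" where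
  "F_hat_Gam X n b x \<omega> = (1 / real n) * (\<Sum>i<n. K_Gam_bar (X i \<omega>) (x / b + 1) b)"

text \<open>The parameters are mean and variance, whereas \<^const>\<open>normal_density\<close> takes the standard
  deviation.\<close>

definition normal_law :: "real \<Rightarrow> real \<Rightarrow> real measure" where
  "normal_law m v = density lborel (normal_density m (sqrt v))"

text \<open>\<open>F\<close> vanishes on the negative half-line and is twice differentiable on the open half-line,
  with first and second derivatives \<open>f\<close> and \<open>f'\<close> continuous and bounded there. Nothing is required
  at 0, so that for instance the exponential distribution, whose c.d.f. has a kink at 0, is
  covered.\<close>

definition smooth_cdf_on_half_line ::
    "(real \<Rightarrow> real) \<Rightarrow> (real \<Rightarrow> real) \<Rightarrow> (real \<Rightarrow> real) \<Rightarrow> bool" where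
  "smooth_cdf_on_half_line F f f' \<longleftrightarrow>
     (\<forall>y<0. F y = 0) \<and>
     (\<forall>y>0. (F has_real_derivative f y) (at y)) \<and>
     (\<forall>y>0. (f has_real_derivative f' y) (at y)) \<and>
     continuous_on {0<..} f \<and> bounded (f ` {0<..}) \<and>
     continuous_on {0<..} f' \<and> bounded (f' ` {0<..})"

end

theory Submission
  imports Defs
begin

text \<open>Let \<open>U\<close> be Gamma distributed with shape \<open>x / b + 1\<close> and scale 1. Then \<open>b U\<close> concentrates at \<open>x\<close>,
  with \<open>E (b U - x) = b\<close> and \<open>E (b U - x)\<^sup>2 = b x + 2 b\<^sup>2\<close>, and the kernel at \<open>t\<close> is the
  probability that \<open>t \<le> b U\<close>. By Chebyshev's inequality the kernel tends to the indicator of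
  \<open>t \<le> x\<close> for every \<open>t \<noteq> x\<close>, hence in mean square under the law of the data, which has no atom at
  \<open>x\<close>. The estimator and the empirical c.d.f., both centered and scaled by \<open>sqrt n\<close>, therefore
  differ by a term that vanishes in mean square, and the classical central limit theorem for the
  empirical c.d.f. carries over by a Slutsky argument on characteristic functions. The bias is
  \<open>E F(b U) - F x\<close> by Fubini, and a second-order Taylor expansion together with a fourth moment
  bound shows that it is \<open>b (f x + x f' x / 2) + o(b)\<close>.\<close>

section \<open>The Gamma law and its moments\<close>

text \<open>Only the shape is a parameter: a scale \<open>\<theta>\<close> enters later through the
  dilation \<open>\<theta> * u\<close>, so one family of moments serves every scale.\<close>

definition gamma_law :: "real \<Rightarrow> real measure" where
  "gamma_law \<alpha> = density lborel (\<lambda>u. indicator {0..} u * u powr (\<alpha> - 1) * exp (- u) / Gamma \<alpha>)"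

lemma space_gamma_law [simp]: "space (gamma_law \<alpha>) = UNIV"
  and sets_gamma_law [simp, measurable_cong]: "sets (gamma_law \<alpha>) = sets borel"
  by (simp_all add: gamma_law_def)

lemma has_bochner_integral_Gamma:
  assumes "\<alpha> > 0"
  shows "has_bochner_integral lborel (\<lambda>u::real. indicator {0..} u * u powr (\<alpha> - 1) * exp (- u)) (Gamma \<alpha>)"
proof (rule has_bochner_integral_nn_integral)
  show "(\<integral>\<^sup>+u. ennreal (indicator {0..} u * u powr (\<alpha> - 1) * exp (- u)) \<partial>lborel) = ennreal (Gamma \<alpha>)"
    using Gamma_conv_nn_integral_real[OF assms] by (simp add: exp_minus field_simps)
qed (use Gamma_real_pos[OF assms] in \<open>auto intro: less_imp_le\<close>)

lemma gamma_law_density_nonneg: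
  "\<alpha> > 0 \<Longrightarrow> 0 \<le> indicator {0..} u * u powr (\<alpha> - 1) * exp (- u) / Gamma (\<alpha>::real)"
  by (auto intro!: divide_nonneg_pos Gamma_real_pos)

text \<open>Multiplying the density by \<open>u ^ k\<close> raises the shape from
  \<open>\<alpha>\<close> to \<open>\<alpha> + k\<close>, so the moment is a quotient of two Gamma
  values, that is, a rising factorial.\<close>

lemma has_bochner_integral_gamma_law_power:
  assumes a: "\<alpha> > 0"
  shows "has_bochner_integral (gamma_law \<alpha>) (\<lambda>u. u ^ k) (pochhammer \<alpha> k)"
proof -
  have "\<alpha> \<notin> \<int>\<^sub>\<le>\<^sub>0" using a by (auto elim!: nonpos_Ints_cases)
  then have g: "pochhammer \<alpha> k = Gamma (\<alpha> + k) / Gamma \<alpha>" by (rule pochhammer_Gamma)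
  have "has_bochner_integral lborel (\<lambda>u. indicator {0..} u * u powr (\<alpha> + k - 1) * exp (- u) / Gamma \<alpha>)
    (Gamma (\<alpha> + k) / Gamma \<alpha>)"
    by (intro has_bochner_integral_divide_zero has_bochner_integral_Gamma) (use a in auto)
  also have "(\<lambda>u. indicator {0..} u * u powr (\<alpha> + k - 1) * exp (- u) / Gamma \<alpha>) =
    (\<lambda>u. (indicator {0..} u * u powr (\<alpha> - 1) * exp (- u) / Gamma \<alpha>) *\<^sub>R (u ^ k))" (is "?l = ?r")
  proof
    fix u show "?l u = ?r u"
      \<comment> \<open>At \<open>u = 0\<close> both sides vanish because \<open>0 powr\<close>
        anything is 0, even for \<open>k = 0\<close>; elsewhere the powers add.\<close>
      by (cases "u = 0") (auto simp: indicator_def powr_add powr_diff powr_realpow)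
  qed
  finally show ?thesis
    unfolding gamma_law_def g using a
    by (intro has_bochner_integral_density) (auto intro!: gamma_law_density_nonneg)
qed

lemma prob_space_gamma_law:
  assumes "\<alpha> > 0"
  shows "prob_space (gamma_law \<alpha>)"
proof (rule prob_spaceI)
  let ?d = "\<lambda>u. indicator {0..} u * u powr (\<alpha> - 1) * exp (- u) / Gamma \<alpha>"
  have "has_bochner_integral lborel ?d 1"
    using has_bochner_integral_divide_zero[OF has_bochner_integral_Gamma[OF assms], of "Gamma \<alpha>"]
      Gamma_real_pos[OF assms] by simp
  then have "integrable lborel ?d" "(LINT u|lborel. ?d u) = 1"
    by (simp_all only: has_bochner_integral_iff)
  then have "(\<integral>\<^sup>+u. ennreal (?d u) \<partial>lborel) = 1"
    by (subst nn_integral_eq_integral) (use assms in \<open>auto simp: gamma_law_density_nonneg\<close>)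
  then show "emeasure (gamma_law \<alpha>) (space (gamma_law \<alpha>)) = 1"
    unfolding gamma_law_def by (simp add: emeasure_density)
qed

text \<open>Strict positivity is what the Taylor bound for the c.d.f. requires, since smoothness is
  known on the open half-line only.\<close>

lemma AE_gamma_law_pos: "AE u in gamma_law \<alpha>. u > 0"
proof -
  have "AE u in lborel. u \<noteq> (0::real)" by (rule AE_lborel_singleton)
  then show ?thesis unfolding gamma_law_def
    by (subst AE_density) (auto simp: indicator_def elim!: eventually_mono split: if_splits)
qed

section \<open>The kernel as a Gamma tail probability, and its concentration\<close>

text \<open>Writing the indicator of \<open>{z..}\<close> as a conditional exhibits an integrand
  that is jointly measurable in \<open>z\<close> and \<open>t\<close>.\<close>

lemma borel_measurable_upper_Gamma [measurable]: "upper_Gamma \<alpha> \<in> borel_measurable borel"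
proof -
  have "(\<lambda>z. LINT t|lborel. (if z \<le> t then 1 else 0) *\<^sub>R (t powr (\<alpha> - 1) * exp (- t))) \<in> borel_measurable borel"
    by measurable
  also have "(\<lambda>z. LINT t|lborel. (if z \<le> t then 1 else 0) *\<^sub>R (t powr (\<alpha> - 1) * exp (- t))) = upper_Gamma \<alpha>"
    unfolding upper_Gamma_def set_lebesgue_integral_def by (simp add: indicator_def of_bool_def)
  finally show ?thesis .
qed

lemma borel_measurable_K_Gam_bar [measurable]: "(\<lambda>t. K_Gam_bar t \<alpha> \<theta>) \<in> borel_measurable borel"
  unfolding K_Gam_bar_def by measurable

text \<open>For \<open>t \<ge> 0\<close> the range \<open>{t / \<theta>..}\<close> lies inside
  \<open>{0..}\<close>, so the indicator in the Gamma density is absorbed and the incomplete Gamma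
  integral becomes a tail probability.\<close>

lemma K_Gam_bar_eq:
  assumes "\<alpha> > 0" "\<theta> > 0" "t \<ge> 0"
  shows "K_Gam_bar t \<alpha> \<theta> = (LINT u|gamma_law \<alpha>. of_bool (t \<le> \<theta> * u))"
proof -
  have "(LINT u|gamma_law \<alpha>. of_bool (t \<le> \<theta> * u)) =
     (LINT u|lborel. (indicator {0..} u * u powr (\<alpha> - 1) * exp (- u) / Gamma \<alpha>) *\<^sub>R (of_bool (t \<le> \<theta> * u) :: real))"
    unfolding gamma_law_def
    by (subst integral_density) (auto intro!: gamma_law_density_nonneg assms simp: of_bool_def)
  also have "\<dots> = (LINT u|lborel. indicator {t / \<theta>..} u *\<^sub>R (u powr (\<alpha> - 1) * exp (- u)) / Gamma \<alpha>)"
    using assms order_trans[OF divide_nonneg_pos[OF assms(3,2)]]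
    by (intro Bochner_Integration.integral_cong) (auto simp: indicator_def field_simps)
  also have "\<dots> = K_Gam_bar t \<alpha> \<theta>"
    unfolding K_Gam_bar_def upper_Gamma_def set_lebesgue_integral_def by simp
  finally show ?thesis ..
qed

lemma K_Gam_bar_nonneg: "\<alpha> > 0 \<Longrightarrow> \<theta> > 0 \<Longrightarrow> t \<ge> 0 \<Longrightarrow> 0 \<le> K_Gam_bar t \<alpha> \<theta>"
  by (simp add: K_Gam_bar_eq)

lemma K_Gam_bar_le_1:
  assumes "\<alpha> > 0" "\<theta> > 0" "t \<ge> 0"
  shows "K_Gam_bar t \<alpha> \<theta> \<le> 1"
proof -
  interpret prob_space "gamma_law \<alpha>" using assms by (intro prob_space_gamma_law)
  show ?thesis unfolding K_Gam_bar_eq[OF assms]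
    by (rule integral_le_const) (auto intro!: integrable_const_bound[of _ 1])
qed

text \<open>Binomial expansion reduces each centered moment to rising factorials, and
  \<open>b ^ k * pochhammer (x / b + 1) k\<close> is the product of \<open>x + j * b\<close> over
  \<open>j\<close> from 1 to \<open>k\<close>. That the fourth moment is of order
  \<open>b\<^sup>2\<close> makes the Taylor remainder negligible against \<open>b\<close>.\<close>

lemma gamma_law_scaled_moments:
  assumes b: "b > 0" and x: "x \<ge> 0"
  shows "has_bochner_integral (gamma_law (x / b + 1)) (\<lambda>u. b * u - x) b" (is ?m1)
    and "has_bochner_integral (gamma_law (x / b + 1)) (\<lambda>u. (b * u - x)\<^sup>2) (b * x + 2 * b\<^sup>2)" (is ?m2)
    and "has_bochner_integral (gamma_law (x / b + 1)) (\<lambda>u. (b * u - x) ^ 4)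
           (b\<^sup>2 * (3 * x\<^sup>2 + 26 * b * x + 24 * b\<^sup>2))" (is ?m4)
proof -
  let ?\<alpha> = "x / b + 1"
  have a: "?\<alpha> > 0" using assms by (auto intro: add_nonneg_pos)
  note P = has_bochner_integral_mult_right[OF has_bochner_integral_gamma_law_power[OF a]]
  have "has_bochner_integral (gamma_law ?\<alpha>) (\<lambda>u. b * u ^ 1 - x * u ^ 0) (b * pochhammer ?\<alpha> 1 - x * pochhammer ?\<alpha> 0)"
    by (intro has_bochner_integral_diff P)
  also have "b * pochhammer ?\<alpha> 1 - x * pochhammer ?\<alpha> 0 = b" using b by (simp add: field_simps)
  finally show ?m1 by simp
  have "has_bochner_integral (gamma_law ?\<alpha>) (\<lambda>u. b\<^sup>2 * u ^ 2 - 2 * b * x * u ^ 1 + x\<^sup>2 * u ^ 0)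
     (b\<^sup>2 * pochhammer ?\<alpha> 2 - 2 * b * x * pochhammer ?\<alpha> 1 + x\<^sup>2 * pochhammer ?\<alpha> 0)"
    by (intro has_bochner_integral_diff has_bochner_integral_add P)
  also have "b\<^sup>2 * pochhammer ?\<alpha> 2 - 2 * b * x * pochhammer ?\<alpha> 1 + x\<^sup>2 * pochhammer ?\<alpha> 0 = b * x + 2 * b\<^sup>2"
    using b by (simp add: eval_nat_numeral pochhammer_Suc field_simps)
  also have "(\<lambda>u. b\<^sup>2 * u ^ 2 - 2 * b * x * u ^ 1 + x\<^sup>2 * u ^ 0) = (\<lambda>u. (b * u - x)\<^sup>2)"
    by (simp add: fun_eq_iff power2_eq_square algebra_simps)
  finally show ?m2 .
  have "has_bochner_integral (gamma_law ?\<alpha>)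
     (\<lambda>u. b^4 * u ^ 4 - 4 * b^3 * x * u ^ 3 + 6 * b^2 * x^2 * u ^ 2 - 4 * b * x^3 * u ^ 1 + x^4 * u ^ 0)
     (b^4 * pochhammer ?\<alpha> 4 - 4 * b^3 * x * pochhammer ?\<alpha> 3 + 6 * b^2 * x^2 * pochhammer ?\<alpha> 2
       - 4 * b * x^3 * pochhammer ?\<alpha> 1 + x^4 * pochhammer ?\<alpha> 0)"
    by (intro has_bochner_integral_diff has_bochner_integral_add P)
  also have "b^4 * pochhammer ?\<alpha> 4 - 4 * b^3 * x * pochhammer ?\<alpha> 3 + 6 * b^2 * x^2 * pochhammer ?\<alpha> 2
       - 4 * b * x^3 * pochhammer ?\<alpha> 1 + x^4 * pochhammer ?\<alpha> 0 = b\<^sup>2 * (3 * x\<^sup>2 + 26 * b * x + 24 * b\<^sup>2)"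
    using b by (simp add: eval_nat_numeral pochhammer_Suc field_simps)
  also have "(\<lambda>u. b^4 * u ^ 4 - 4 * b^3 * x * u ^ 3 + 6 * b^2 * x^2 * u ^ 2 - 4 * b * x^3 * u ^ 1 + x^4 * u ^ 0)
     = (\<lambda>u. (b * u - x) ^ 4)"
    by (simp add: fun_eq_iff eval_nat_numeral algebra_simps)
  finally show ?m4 .
qed

text \<open>Chebyshev's argument: the two indicators can differ only when \<open>t\<close> separates
  \<open>x\<close> from \<open>b * u\<close>, and then the distance from \<open>b * u\<close> to
  \<open>x\<close> is at least that from \<open>t\<close> to \<open>x\<close>.\<close>

lemma K_Gam_bar_minus_indicator_le:
  assumes b: "b > 0" and x: "x \<ge> 0" and t: "t \<ge> 0" "t \<noteq> x"
  shows "\<bar>K_Gam_bar t (x / b + 1) b - of_bool (t \<le> x)\<bar> \<le> (b * x + 2 * b\<^sup>2) / (t - x)\<^sup>2"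
proof -
  let ?\<alpha> = "x / b + 1"
  have a: "?\<alpha> > 0" using assms by (auto intro: add_nonneg_pos)
  interpret prob_space "gamma_law ?\<alpha>" using a by (rule prob_space_gamma_law)
  note m2 = gamma_law_scaled_moments(2)[OF b x, unfolded has_bochner_integral_iff]
  have I: "integrable (gamma_law ?\<alpha>) (\<lambda>u. of_bool (t \<le> b * u) :: real)"
    by (auto intro!: integrable_const_bound[of _ 1])
  have pw: "\<bar>of_bool (t \<le> b * u) - of_bool (t \<le> x)\<bar> \<le> (b * u - x)\<^sup>2 / (t - x)\<^sup>2" for u
  proof (cases "t \<le> b * u \<longleftrightarrow> t \<le> x")
    case False
    then have "\<bar>t - x\<bar> \<le> \<bar>b * u - x\<bar>" by auto
    then have "(t - x)\<^sup>2 \<le> (b * u - x)\<^sup>2" by (simp add: abs_le_square_iff)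
    then show ?thesis using False t by (auto simp: le_divide_eq)
  qed auto
  have "K_Gam_bar t ?\<alpha> b - of_bool (t \<le> x) = (LINT u|gamma_law ?\<alpha>. of_bool (t \<le> b * u) - of_bool (t \<le> x))"
    unfolding K_Gam_bar_eq[OF a b t(1)] using I by (simp add: prob_space[simplified])
  also have "\<bar>\<dots>\<bar> \<le> (LINT u|gamma_law ?\<alpha>. \<bar>of_bool (t \<le> b * u) - of_bool (t \<le> x)\<bar>)"
    by (rule integral_abs_bound)
  also have "\<dots> \<le> (LINT u|gamma_law ?\<alpha>. (b * u - x)\<^sup>2 / (t - x)\<^sup>2)"
    using I m2 by (intro integral_mono pw) (auto intro!: integrable_abs Bochner_Integration.integrable_diff)
  also have "\<dots> = (b * x + 2 * b\<^sup>2) / (t - x)\<^sup>2" using m2 by simp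
  finally show ?thesis .
qed

section \<open>Averaging the kernel over the law of the data\<close>

text \<open>The c.d.f. may be positive at 0, so the negative half-line is exhausted by the null sets
  \<open>{..- inverse (real (Suc n))}\<close> instead of being bounded by the value at 0.\<close>

lemma (in real_distribution) AE_nonneg_if_cdf_neg_0:
  assumes "\<forall>y<0. cdf M y = 0"
  shows "AE t in M. 0 \<le> t"
proof -
  have "AE t in M. \<forall>n. t \<notin> {..- inverse (real (Suc n))}"
    unfolding AE_all_countable
  proof
    fix n
    have "prob {..- inverse (real (Suc n))} = 0"
      using assms[rule_format, of "- inverse (real (Suc n))"] by (simp add: cdf_def)
    then show "AE t in M. t \<notin> {..- inverse (real (Suc n))}"
      by (subst (asm) prob_eq_0) auto
  qed
  then show ?thesis
  proof (rule eventually_mono)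
    fix t assume *: "\<forall>n. t \<notin> {..- inverse (real (Suc n))}"
    show "0 \<le> t"
    proof (rule ccontr)
      assume "\<not> 0 \<le> t"
      then obtain n where "inverse (real (Suc n)) < - t" using reals_Archimedean[of "- t"] by auto
      with * show False by (auto dest!: spec[of _ n])
    qed
  qed
qed

text \<open>Dominated convergence with the constant 1: kernel and indicator both lie between 0 and
  1, and the Chebyshev bound gives the pointwise limit off the null set \<open>{x}\<close>.\<close>

lemma (in real_distribution) K_Gam_bar_L2_tendsto:
  assumes neg: "\<forall>y<0. cdf M y = 0" and x: "x \<ge> 0" and atom: "prob {x} = 0"
    and b: "\<And>n. b n > 0" "b \<longlonglongrightarrow> 0"
  shows "(\<lambda>n. LINT t|M. (K_Gam_bar t (x / b n + 1) (b n) - of_bool (t \<le> x))\<^sup>2) \<longlonglongrightarrow> 0"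
proof -
  have a: "x / b n + 1 > 0" for n using b(1)[of n] x by (auto intro: add_nonneg_pos)
  have ne: "AE t in M. t \<noteq> x" using prob_eq_0[of "{x}"] atom by simp
  have lim: "(\<lambda>n. (K_Gam_bar t (x / b n + 1) (b n) - of_bool (t \<le> x))\<^sup>2) \<longlonglongrightarrow> 0"
    if t: "0 \<le> t" "t \<noteq> x" for t
  proof -
    have "(\<lambda>n. (b n * x + 2 * (b n)\<^sup>2) / (t - x)\<^sup>2) \<longlonglongrightarrow> (0 * x + 2 * 0\<^sup>2) / (t - x)\<^sup>2"
      using t by (intro tendsto_intros b) auto
    then have *: "(\<lambda>n. (b n * x + 2 * (b n)\<^sup>2) / (t - x)\<^sup>2) \<longlonglongrightarrow> 0" by simp
    have "(\<lambda>n. K_Gam_bar t (x / b n + 1) (b n) - of_bool (t \<le> x)) \<longlonglongrightarrow> 0"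
      by (intro Lim_null_comparison[OF _ *] always_eventually allI)
        (simp only: real_norm_def K_Gam_bar_minus_indicator_le[OF b(1) x t])
    from tendsto_power[OF this, of 2] show ?thesis by simp
  qed
  have bnd: "(K_Gam_bar t (x / b n + 1) (b n) - of_bool (t \<le> x))\<^sup>2 \<le> 1" if "0 \<le> t" for t n
    using K_Gam_bar_nonneg[OF a b(1) that, of n n] K_Gam_bar_le_1[OF a b(1) that, of n n]
    by (auto simp: abs_square_le_1)
  have "(\<lambda>n. LINT t|M. (K_Gam_bar t (x / b n + 1) (b n) - of_bool (t \<le> x))\<^sup>2) \<longlonglongrightarrow> (LINT t|M. 0)"
  proof (rule integral_dominated_convergence[where w="\<lambda>_. 1"])
    show "AE t in M. (\<lambda>n. (K_Gam_bar t (x / b n + 1) (b n) - of_bool (t \<le> x))\<^sup>2) \<longlonglongrightarrow> 0"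
      using AE_nonneg_if_cdf_neg_0[OF neg] ne by eventually_elim (rule lim)
    show "AE t in M. norm ((K_Gam_bar t (x / b n + 1) (b n) - of_bool (t \<le> x))\<^sup>2) \<le> 1" for n
      using AE_nonneg_if_cdf_neg_0[OF neg] by eventually_elim (use bnd in simp)
  qed (auto simp: of_bool_def)
  then show ?thesis by simp
qed

text \<open>Fubini's theorem for the event \<open>t \<le> \<theta> * u\<close>. It turns the mean of
  the estimator into a Gamma average of the c.d.f., to which Taylor's formula applies.\<close>

lemma (in real_distribution) integral_K_Gam_bar:
  assumes neg: "\<forall>y<0. cdf M y = 0" and a: "\<alpha> > 0" "\<theta> > 0"
  shows "(LINT t|M. K_Gam_bar t \<alpha> \<theta>) = (LINT u|gamma_law \<alpha>. cdf M (\<theta> * u))"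
proof -
  interpret G: prob_space "gamma_law \<alpha>" using a by (intro prob_space_gamma_law)
  interpret P: pair_prob_space M "gamma_law \<alpha>" ..
  let ?f = "\<lambda>t u. of_bool (t \<le> \<theta> * u) :: real"
  have I: "integrable (M \<Otimes>\<^sub>M gamma_law \<alpha>) (case_prod ?f)"
    by (rule P.integrable_const_bound[of _ 1]) (auto simp: of_bool_def)
  have "(LINT t|M. K_Gam_bar t \<alpha> \<theta>) = (LINT t|M. LINT u|gamma_law \<alpha>. ?f t u)"
  proof (rule integral_cong_AE)
    show "AE t in M. K_Gam_bar t \<alpha> \<theta> = (LINT u|gamma_law \<alpha>. ?f t u)"
      using AE_nonneg_if_cdf_neg_0[OF neg] by eventually_elim (rule K_Gam_bar_eq[OF a])
  qed (auto simp: of_bool_def)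
  also have "\<dots> = (LINT u|gamma_law \<alpha>. LINT t|M. ?f t u)"
    using P.Fubini_integral[OF I] by simp
  also have "\<dots> = (LINT u|gamma_law \<alpha>. cdf M (\<theta> * u))"
  proof (rule Bochner_Integration.integral_cong[OF refl])
    fix u
    have "?f t u = indicator {..\<theta> * u} t" for t by (simp add: indicator_def)
    then show "(LINT t|M. ?f t u) = cdf M (\<theta> * u)" by (simp add: cdf_def)
  qed
  finally show ?thesis .
qed

section \<open>The smoothing bias\<close>

text \<open>In the Lagrange remainder, continuity of \<open>f'\<close> at \<open>x\<close> gives the
  term with \<open>e\<close> near \<open>x\<close>. Farther away only boundedness of
  \<open>f'\<close> is available, and the missing smallness is paid for by a fourth power. The bound
  holds for all \<open>y > 0\<close>, so it can be integrated against the Gamma law.\<close>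

lemma smooth_cdf_Taylor_bound:
  assumes F: "smooth_cdf_on_half_line F f f'" and x: "x > 0" and e: "e > 0"
  obtains C where "C \<ge> 0" "\<And>y. y > 0 \<Longrightarrow>
    \<bar>F y - F x - f x * (y - x) - f' x / 2 * (y - x)\<^sup>2\<bar> \<le> e * (y - x)\<^sup>2 + C * (y - x) ^ 4"
proof -
  have dF: "\<And>y. y > 0 \<Longrightarrow> (F has_real_derivative f y) (at y)"
    and df: "\<And>y. y > 0 \<Longrightarrow> (f has_real_derivative f' y) (at y)"
    and cf: "continuous_on {0<..} f'" and bf: "bounded (f' ` {0<..})"
    using F unfolding smooth_cdf_on_half_line_def by auto
  from bf obtain B where B: "B > 0" "\<And>y. y > 0 \<Longrightarrow> \<bar>f' y\<bar> \<le> B"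
    unfolding bounded_pos by auto
  from cf x e obtain d where d: "d > 0" "\<And>z. z > 0 \<Longrightarrow> \<bar>z - x\<bar> < d \<Longrightarrow> \<bar>f' z - f' x\<bar> < e"
    unfolding continuous_on_iff dist_real_def by (metis greaterThan_iff)
  show ?thesis
  proof
    \<comment> \<open>The constant comes from the far region: there
      \<open>1 \<le> (y - x)\<^sup>2 / d\<^sup>2\<close>, so the bound \<open>B\<close> for half the
      difference of two values of \<open>f'\<close> may be multiplied by this ratio.\<close>
    show "B / d\<^sup>2 \<ge> 0" using B by simp
    fix y :: real assume y: "y > 0"
    show "\<bar>F y - F x - f x * (y - x) - f' x / 2 * (y - x)\<^sup>2\<bar> \<le> e * (y - x)\<^sup>2 + B / d\<^sup>2 * (y - x) ^ 4"
    proof (cases "y = x")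
      case False
      \<comment> \<open>The derivatives indexed by their order, as \<open>Taylor\<close> expects
        them.\<close>
      define D where "D m = (if m = 0 then F else if m = 1 then f else f')" for m :: nat
      have "\<exists>t. (if y < x then y < t \<and> t < x else x < t \<and> t < y) \<and>
        F y = (\<Sum>m<2. (D m x / fact m) * (y - x) ^ m) + (D 2 t / fact 2) * (y - x) ^ 2"
        by (rule Taylor[where a="min x y" and b="max x y"])
           (use False x y in \<open>auto simp: D_def less_2_cases_iff intro!: dF df\<close>)
      then obtain t where t: "if y < x then y < t \<and> t < x else x < t \<and> t < y"
        and Fy: "F y = F x + f x * (y - x) + f' t / 2 * (y - x)\<^sup>2"
        by (auto simp: D_def numeral_2_eq_2)
      have t0: "t > 0" using t x y by (auto split: if_splits)
      have tx: "\<bar>t - x\<bar> \<le> \<bar>y - x\<bar>" using t by (auto split: if_splits)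
      have eq: "F y - F x - f x * (y - x) - f' x / 2 * (y - x)\<^sup>2 = (f' t - f' x) / 2 * (y - x)\<^sup>2"
        unfolding Fy by (simp add: field_simps)
      have "\<bar>f' t - f' x\<bar> / 2 \<le> e + B / d\<^sup>2 * (y - x)\<^sup>2"
      proof (cases "\<bar>y - x\<bar> < d")
        case True
        then have "\<bar>f' t - f' x\<bar> < e" using d(2)[OF t0] tx by auto
        moreover have "0 \<le> B / d\<^sup>2 * (y - x)\<^sup>2" using B by simp
        ultimately show ?thesis by (intro add_increasing2) auto
      next
        case False
        then have "d\<^sup>2 \<le> (y - x)\<^sup>2" using d(1) by (subst abs_le_square_iff[symmetric]) auto
        then have "B * 1 \<le> B * ((y - x)\<^sup>2 / d\<^sup>2)" using B d(1) by (intro mult_left_mono) auto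
        then have "2 * B \<le> 2 * (B / d\<^sup>2 * (y - x)\<^sup>2)" by simp
        moreover have "\<bar>f' t - f' x\<bar> \<le> 2 * B" using B(2)[OF t0] B(2)[OF x] by linarith
        ultimately have "\<bar>f' t - f' x\<bar> \<le> 2 * (B / d\<^sup>2 * (y - x)\<^sup>2)" by (rule order_trans[rotated])
        then have "\<bar>f' t - f' x\<bar> / 2 \<le> B / d\<^sup>2 * (y - x)\<^sup>2" by (simp add: mult.commute)
        then show ?thesis using e by (intro add_increasing) auto
      qed
      then have "\<bar>f' t - f' x\<bar> / 2 * (y - x)\<^sup>2 \<le> (e + B / d\<^sup>2 * (y - x)\<^sup>2) * (y - x)\<^sup>2"
        by (intro mult_right_mono) auto
      then show ?thesis unfolding eq
        by (simp add: abs_mult distrib_right power4_eq_xxxx power2_eq_square mult.assoc)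
    qed simp
  qed
qed

text \<open>Integrating the Taylor bound against the Gamma law leaves the main term
  \<open>f x * b + f' x / 2 * (b * x + 2 * b\<^sup>2)\<close>. After division by \<open>b\<close>
  the error is at most \<open>e * x\<close> up to terms of order \<open>b\<close>, with
  \<open>e\<close> arbitrary.\<close>

lemma (in real_distribution) gamma_smoothing_bias:
  assumes F: "smooth_cdf_on_half_line (cdf M) f f'" and x: "x > 0"
    and b: "\<And>n. b n > 0" "b \<longlonglongrightarrow> 0"
  shows "(\<lambda>n. ((LINT u|gamma_law (x / b n + 1). cdf M (b n * u)) - cdf M x) / b n)
    \<longlonglongrightarrow> f x + x / 2 * f' x"
proof -
  let ?G = "\<lambda>n. gamma_law (x / b n + 1)"
  let ?m = "\<lambda>n. LINT u|?G n. cdf M (b n * u)"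
  have a: "x / b n + 1 > 0" for n using b(1)[of n] x by (auto intro: add_nonneg_pos)
  note mom = gamma_law_scaled_moments[OF b(1) less_imp_le[OF x], unfolded has_bochner_integral_iff]
  \<comment> \<open>Stated for all \<open>e\<close> and \<open>C\<close>, because they are fixed
    only once the tolerance in the limit is given.\<close>
  have bound: "\<bar>?m n - cdf M x - f x * b n - f' x / 2 * (b n * x + 2 * (b n)\<^sup>2)\<bar>
      \<le> e * (b n * x + 2 * (b n)\<^sup>2) + C * ((b n)\<^sup>2 * (3 * x\<^sup>2 + 26 * b n * x + 24 * (b n)\<^sup>2))"
    if C: "\<And>y. y > 0 \<Longrightarrow> \<bar>cdf M y - cdf M x - f x * (y - x) - f' x / 2 * (y - x)\<^sup>2\<bar>
      \<le> e * (y - x)\<^sup>2 + C * (y - x) ^ 4" for e C n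
  proof -
    interpret G: prob_space "?G n" by (rule prob_space_gamma_law[OF a])
    let ?R = "\<lambda>u. cdf M (b n * u) - cdf M x - f x * (b n * u - x) - f' x / 2 * (b n * u - x)\<^sup>2"
    have [measurable]: "cdf M \<in> borel_measurable borel"
      by (intro borel_measurable_mono monoI cdf_nondecreasing)
    have I: "integrable (?G n) (\<lambda>u. cdf M (b n * u))"
      by (rule G.integrable_const_bound[of _ 1]) (auto simp: cdf_nonneg cdf_bounded_prob)
    have IR: "integrable (?G n) ?R" using I mom[of n] by auto
    have "\<bar>LINT u|?G n. ?R u\<bar> \<le> (LINT u|?G n. \<bar>?R u\<bar>)" by (rule integral_abs_bound)
    also have "\<dots> \<le> (LINT u|?G n. e * (b n * u - x)\<^sup>2 + C * (b n * u - x) ^ 4)"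
    proof (rule integral_mono_AE)
      show "AE u in ?G n. \<bar>?R u\<bar> \<le> e * (b n * u - x)\<^sup>2 + C * (b n * u - x) ^ 4"
        using AE_gamma_law_pos by eventually_elim (use C b(1)[of n] in simp)
    qed (use IR mom[of n] in auto)
    also have "\<dots> = e * (b n * x + 2 * (b n)\<^sup>2) + C * ((b n)\<^sup>2 * (3 * x\<^sup>2 + 26 * b n * x + 24 * (b n)\<^sup>2))"
      using mom[of n] by simp
    also have "(LINT u|?G n. ?R u) = ?m n - cdf M x - f x * b n - f' x / 2 * (b n * x + 2 * (b n)\<^sup>2)"
      using I mom[of n] by (simp add: G.prob_space[simplified])
    finally show ?thesis .
  qed
  define r where "r n = (?m n - cdf M x) / b n - f x - f' x / 2 * (x + 2 * b n)" for n
  have "r \<longlonglongrightarrow> 0"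
  proof (rule tendstoI)
    fix d :: real assume d: "d > 0"
    \<comment> \<open>With this choice the error bound \<open>?u\<close> below has limit
      \<open>e * x = d / 2\<close> as its argument tends to 0.\<close>
    define e where "e = d / (2 * x)"
    have e: "e > 0" "e * x < d" using d x by (auto simp: e_def)
    obtain C where "C \<ge> 0" and C: "\<And>y. y > 0 \<Longrightarrow> \<bar>cdf M y - cdf M x - f x * (y - x) - f' x / 2 * (y - x)\<^sup>2\<bar>
      \<le> e * (y - x)\<^sup>2 + C * (y - x) ^ 4"
      using smooth_cdf_Taylor_bound[OF F x e(1)] by blast
    let ?u = "\<lambda>h. e * (x + 2 * h) + C * (h * (3 * x\<^sup>2 + 26 * h * x + 24 * h\<^sup>2))"
    have le: "\<bar>r n\<bar> \<le> ?u (b n)" for n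
    proof -
      have "\<bar>r n\<bar> * b n = \<bar>r n * b n\<bar>" using b(1)[of n] by (simp add: abs_mult)
      also have "r n * b n = ?m n - cdf M x - f x * b n - f' x / 2 * (b n * x + 2 * (b n)\<^sup>2)"
        using b(1)[of n] by (simp add: r_def field_simps power2_eq_square)
      also have "\<bar>\<dots>\<bar> \<le> e * (b n * x + 2 * (b n)\<^sup>2) + C * ((b n)\<^sup>2 * (3 * x\<^sup>2 + 26 * b n * x + 24 * (b n)\<^sup>2))"
        by (rule bound) (rule C)
      also have "\<dots> = ?u (b n) * b n" by (simp add: algebra_simps power2_eq_square)
      finally show ?thesis using b(1)[of n] by simp
    qed
    have "(\<lambda>n. ?u (b n)) \<longlonglongrightarrow> ?u 0" by (intro tendsto_intros b)
    then have "eventually (\<lambda>n. ?u (b n) < d) sequentially" by (rule order_tendstoD) (use e in simp)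
    then show "eventually (\<lambda>n. dist (r n) 0 < d) sequentially"
      by eventually_elim (use le in \<open>auto intro: le_less_trans\<close>)
  qed
  then have "(\<lambda>n. r n + f x + f' x / 2 * (x + 2 * b n)) \<longlonglongrightarrow> 0 + f x + f' x / 2 * (x + 2 * 0)"
    by (intro tendsto_intros b)
  then show ?thesis by (simp add: r_def mult.commute)
qed

section \<open>Slutsky's argument and affine images of the normal law\<close>

text \<open>Since \<open>iexp\<close> is 1-Lipschitz, the characteristic functions of
  \<open>W n\<close> and \<open>c + s * Y n\<close> differ at \<open>t\<close> by at most
  \<open>\<bar>t\<bar>\<close> times the mean absolute difference. Levy's continuity theorem does
  the rest.\<close>

lemma (in prob_space) weak_conv_m_affine_approx:
  assumes [measurable]: "\<And>n. random_variable borel (Y n)" "\<And>n. random_variable borel (W n)"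
    and mu: "real_distribution \<mu>" and conv: "weak_conv_m (\<lambda>n. distr M borel (Y n)) \<mu>"
    and int: "\<And>n. integrable M (\<lambda>\<omega>. W n \<omega> - (c + s * Y n \<omega>))"
    and approx: "(\<lambda>n. expectation (\<lambda>\<omega>. \<bar>W n \<omega> - (c + s * Y n \<omega>)\<bar>)) \<longlonglongrightarrow> 0"
  shows "weak_conv_m (\<lambda>n. distr M borel (W n)) (distr \<mu> borel (\<lambda>y. c + s * y))"
proof (rule levy_continuity)
  interpret \<mu>: real_distribution \<mu> by fact
  show "real_distribution (distr M borel (W n))" for n by (rule real_distribution_distr) simp
  show "real_distribution (distr \<mu> borel (\<lambda>y. c + s * y))" by (rule \<mu>.real_distribution_distr) simp
  fix t :: real
  have e: "iexp (t * (c + s * y)) = iexp (t * c) * iexp (t * s * y)" for y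
    by (simp add: exp_add[symmetric] algebra_simps)
  have char_lim: "char (distr \<mu> borel (\<lambda>y. c + s * y)) t = iexp (t * c) * char \<mu> (t * s)"
    unfolding char_def by (subst integral_distr) (simp_all only: e borel_measurable_const, auto)
  have "(\<lambda>n. char (distr M borel (W n)) t - iexp (t * c) * char (distr M borel (Y n)) (t * s)) \<longlonglongrightarrow> 0"
  proof (rule Lim_null_comparison[OF always_eventually[OF allI]])
    fix n
    have i1: "integrable M (\<lambda>\<omega>. iexp (t * W n \<omega>))"
      and i2: "integrable M (\<lambda>\<omega>. iexp (t * (c + s * Y n \<omega>)))"
      by (intro integrable_const_bound[of _ 1]; simp)+
    have cW: "char (distr M borel (W n)) t = (CLINT \<omega>|M. iexp (t * W n \<omega>))"
      unfolding char_def by (simp add: integral_distr)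
    have cY: "iexp (t * c) * char (distr M borel (Y n)) (t * s) = (CLINT \<omega>|M. iexp (t * (c + s * Y n \<omega>)))"
      unfolding char_def e by (simp add: integral_distr)
    have "char (distr M borel (W n)) t - iexp (t * c) * char (distr M borel (Y n)) (t * s) =
      (CLINT \<omega>|M. iexp (t * W n \<omega>) - iexp (t * (c + s * Y n \<omega>)))"
      using i1 i2 by (simp only: Bochner_Integration.integral_diff cW cY)
    also have "norm \<dots> \<le> (LINT \<omega>|M. norm (iexp (t * W n \<omega>) - iexp (t * (c + s * Y n \<omega>))))"
      by (rule integral_norm_bound)
    also have "\<dots> \<le> (LINT \<omega>|M. \<bar>t\<bar> * \<bar>W n \<omega> - (c + s * Y n \<omega>)\<bar>)"
    proof (rule integral_mono)
      show "norm (iexp (t * W n \<omega>) - iexp (t * (c + s * Y n \<omega>))) \<le> \<bar>t\<bar> * \<bar>W n \<omega> - (c + s * Y n \<omega>)\<bar>" for \<omega>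
      proof -
        define p q where "p = t * W n \<omega>" and "q = t * (c + s * Y n \<omega>)"
        \<comment> \<open>Pulling out a factor of modulus 1 reduces the Lipschitz bound to the
          first-order estimate of \<open>iexp\<close> at 0.\<close>
        have "iexp p - iexp q = iexp q * (iexp (p - q) - 1)"
          by (simp add: exp_diff algebra_simps)
        then have "norm (iexp p - iexp q) = norm (iexp (p - q) - 1)"
          by (simp add: norm_mult)
        also have "\<dots> \<le> \<bar>p - q\<bar>" using iexp_approx1[of "p - q" 0] by simp
        also have "\<dots> = \<bar>t\<bar> * \<bar>W n \<omega> - (c + s * Y n \<omega>)\<bar>"
          by (simp add: p_def q_def abs_mult[symmetric] right_diff_distrib)
        finally show ?thesis by (simp only: p_def q_def)
      qed
    qed (use i1 i2 int in auto)
    also have "\<dots> = \<bar>t\<bar> * expectation (\<lambda>\<omega>. \<bar>W n \<omega> - (c + s * Y n \<omega>)\<bar>)" by simp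
    finally show "norm (char (distr M borel (W n)) t - iexp (t * c) * char (distr M borel (Y n)) (t * s))
      \<le> \<bar>t\<bar> * expectation (\<lambda>\<omega>. \<bar>W n \<omega> - (c + s * Y n \<omega>)\<bar>)" .
  qed (use tendsto_mult_right_zero[OF approx] in simp)
  moreover have "(\<lambda>n. iexp (t * c) * char (distr M borel (Y n)) (t * s)) \<longlonglongrightarrow> iexp (t * c) * char \<mu> (t * s)"
    by (intro tendsto_mult_left levy_continuity1[OF _ mu conv] real_distribution_distr) simp
  ultimately show "(\<lambda>n. char (distr M borel (W n)) t) \<longlonglongrightarrow> char (distr \<mu> borel (\<lambda>y. c + s * y)) t"
    unfolding char_lim using tendsto_add by fastforce
qed

lemma distr_affine_std_normal:
  assumes "v > 0"
  shows "distr std_normal_distribution borel (\<lambda>y. m + sqrt v * y) = normal_law m v"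
proof -
  interpret S: prob_space std_normal_distribution by (rule prob_space_normal_density) simp
  have "distributed std_normal_distribution lborel (\<lambda>y. y) std_normal_density"
    by (auto simp: distributed_def intro!: distr_id2)
  from S.normal_density_affine[OF this, of "sqrt v" m] assms
  have "distr std_normal_distribution lborel (\<lambda>y. m + sqrt v * y) = normal_law m v"
    by (simp add: distributed_def normal_law_def)
  \<comment> \<open>The targets \<open>lborel\<close> and \<open>borel\<close> have the same
    measurable sets, hence give the same image measure.\<close>
  then show ?thesis by (simp cong: distr_cong)
qed

section \<open>Second moments of normalized sums\<close>

text \<open>Cross terms vanish: each new variable is independent of the centered sum so far. The
  form with \<open>has_bochner_integral\<close> carries integrability through the induction together
  with the value.\<close>

lemma (in prob_space) sum_indep_vars_square:
  fixes V :: "'i \<Rightarrow> 'a \<Rightarrow> real"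
  assumes "finite I" "indep_vars (\<lambda>_. borel) V I"
    and "\<And>i. i \<in> I \<Longrightarrow> integrable M (\<lambda>\<omega>. (V i \<omega>)\<^sup>2)" "\<And>i. i \<in> I \<Longrightarrow> expectation (V i) = 0"
  shows "has_bochner_integral M (\<lambda>\<omega>. (\<Sum>i\<in>I. V i \<omega>)\<^sup>2) (\<Sum>i\<in>I. expectation (\<lambda>\<omega>. (V i \<omega>)\<^sup>2))"
  using assms
proof (induction I rule: finite_induct)
  case (insert i I)
  let ?S = "\<lambda>\<omega>. \<Sum>i\<in>I. V i \<omega>"
  have rv: "random_variable borel (V j)" if "j \<in> insert i I" for j
    using insert.prems(1) that unfolding indep_vars_def2 by auto
  have int: "integrable M (V j)" if "j \<in> insert i I" for j
    by (rule square_integrable_imp_integrable[OF rv[OF that] insert.prems(2)[OF that]])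
  have S: "integrable M ?S" using int by (intro Bochner_Integration.integrable_sum) auto
  have ES: "expectation ?S = 0" using int insert.prems(3) by (subst Bochner_Integration.integral_sum) auto
  have ind: "indep_var borel (V i) borel ?S" by (rule indep_vars_sum) (use insert in auto)
  have IH: "has_bochner_integral M (\<lambda>\<omega>. (?S \<omega>)\<^sup>2) (\<Sum>i\<in>I. expectation (\<lambda>\<omega>. (V i \<omega>)\<^sup>2))"
    by (intro insert.IH indep_vars_subset[OF insert.prems(1)] insert.prems(2,3)) auto
  have VS: "has_bochner_integral M (\<lambda>\<omega>. V i \<omega> * ?S \<omega>) 0"
    using indep_var_lebesgue_integral[OF ind int S] indep_var_integrable[OF ind int S] ES
    by (simp add: has_bochner_integral_iff)
  have Vi: "has_bochner_integral M (\<lambda>\<omega>. (V i \<omega>)\<^sup>2) (expectation (\<lambda>\<omega>. (V i \<omega>)\<^sup>2))"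
    using insert.prems(2) by (simp add: has_bochner_integral_iff)
  have "has_bochner_integral M (\<lambda>\<omega>. (V i \<omega>)\<^sup>2 + 2 * (V i \<omega> * ?S \<omega>) + (?S \<omega>)\<^sup>2)
    (expectation (\<lambda>\<omega>. (V i \<omega>)\<^sup>2) + 2 * 0 + (\<Sum>i\<in>I. expectation (\<lambda>\<omega>. (V i \<omega>)\<^sup>2)))"
    by (intro has_bochner_integral_add has_bochner_integral_mult_right Vi VS IH)
  then show ?case using insert.hyps by (simp add: power2_sum algebra_simps)
qed (simp add: has_bochner_integral_zero)

text \<open>This is nonnegativity of the variance of \<open>\<bar>S \<omega>\<bar>\<close>.\<close>

lemma (in prob_space) expectation_abs_le_sqrt:
  fixes S :: "'a \<Rightarrow> real"
  assumes [measurable]: "random_variable borel S" and sq: "integrable M (\<lambda>\<omega>. (S \<omega>)\<^sup>2)"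
  shows "expectation (\<lambda>\<omega>. \<bar>S \<omega>\<bar>) \<le> sqrt (expectation (\<lambda>\<omega>. (S \<omega>)\<^sup>2))"
proof -
  have "integrable M (\<lambda>\<omega>. \<bar>S \<omega>\<bar>)"
    by (rule integrable_abs[OF square_integrable_imp_integrable[OF assms]])
  then have "(expectation (\<lambda>\<omega>. \<bar>S \<omega>\<bar>))\<^sup>2 \<le> expectation (\<lambda>\<omega>. (S \<omega>)\<^sup>2)"
    using variance_eq[of "\<lambda>\<omega>. \<bar>S \<omega>\<bar>"] variance_positive[of "\<lambda>\<omega>. \<bar>S \<omega>\<bar>"] sq by simp
  then show ?thesis by (rule real_le_rsqrt)
qed

text \<open>Centering can only lower the second moment, and by independence the variance of the
  normalized sum does not grow with \<open>n\<close>. A mean-square small \<open>h\<close> thus has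
  a normalized sum small in mean, uniformly in \<open>n\<close>.\<close>

lemma (in prob_space) iid_normalized_sum_abs_le:
  fixes X :: "nat \<Rightarrow> 'a \<Rightarrow> real" and h :: "real \<Rightarrow> real"
  assumes X: "indep_vars (\<lambda>_. borel) X UNIV" and D: "\<And>i. distr M borel (X i) = \<mu>"
    and h[measurable]: "h \<in> borel_measurable borel" and sq: "integrable \<mu> (\<lambda>t. (h t)\<^sup>2)"
  shows "integrable M (\<lambda>\<omega>. (\<Sum>i<n. h (X i \<omega>) - integral\<^sup>L \<mu> h) / sqrt n)"
    and "expectation (\<lambda>\<omega>. \<bar>(\<Sum>i<n. h (X i \<omega>) - integral\<^sup>L \<mu> h) / sqrt n\<bar>) \<le> sqrt (LINT t|\<mu>. (h t)\<^sup>2)"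
proof -
  have [measurable]: "random_variable borel (X i)" for i using X unfolding indep_vars_def2 by simp
  have sqX: "integrable M (\<lambda>\<omega>. (h (X i \<omega>))\<^sup>2)" for i
    using sq unfolding D[of i, symmetric] by (subst (asm) integrable_distr_eq) auto
  have intX: "integrable M (\<lambda>\<omega>. h (X i \<omega>))" for i
    by (rule square_integrable_imp_integrable[OF _ sqX]) simp
  have EX: "expectation (\<lambda>\<omega>. h (X i \<omega>)) = integral\<^sup>L \<mu> h" for i
    unfolding D[of i, symmetric] by (subst integral_distr) auto
  have EX2: "expectation (\<lambda>\<omega>. (h (X i \<omega>))\<^sup>2) = (LINT t|\<mu>. (h t)\<^sup>2)" for i
    unfolding D[of i, symmetric] by (subst integral_distr) auto
  define V where "V i \<omega> = h (X i \<omega>) - integral\<^sup>L \<mu> h" for i \<omega>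
  have [measurable]: "random_variable borel (V i)" for i unfolding V_def by measurable
  have Vsq: "integrable M (\<lambda>\<omega>. (V i \<omega>)\<^sup>2)" for i
    unfolding V_def power2_diff using sqX[of i] intX[of i] by auto
  have EV: "expectation (V i) = 0" for i
    unfolding V_def using intX[of i] EX[of i] by (simp add: prob_space)
  have EV2: "expectation (\<lambda>\<omega>. (V i \<omega>)\<^sup>2) \<le> (LINT t|\<mu>. (h t)\<^sup>2)" for i
    using variance_eq[OF intX[of i] sqX[of i]] unfolding V_def EX EX2 by simp
  have ind: "indep_vars (\<lambda>_. borel) V {..<n}"
    unfolding V_def by (rule indep_vars_compose2[OF indep_vars_subset[OF X]]) auto
  let ?S = "\<lambda>\<omega>. (\<Sum>i<n. V i \<omega>) / sqrt n"
  have "has_bochner_integral M (\<lambda>\<omega>. (\<Sum>i<n. V i \<omega>)\<^sup>2 / n) ((\<Sum>i<n. expectation (\<lambda>\<omega>. (V i \<omega>)\<^sup>2)) / n)"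
    by (intro has_bochner_integral_divide_zero sum_indep_vars_square ind Vsq EV) auto
  then have S2: "integrable M (\<lambda>\<omega>. (?S \<omega>)\<^sup>2)"
    "expectation (\<lambda>\<omega>. (?S \<omega>)\<^sup>2) = (\<Sum>i<n. expectation (\<lambda>\<omega>. (V i \<omega>)\<^sup>2)) / n"
    by (simp_all add: has_bochner_integral_iff power_divide)
  have "integrable M ?S" by (rule square_integrable_imp_integrable[OF _ S2(1)]) simp
  then show "integrable M (\<lambda>\<omega>. (\<Sum>i<n. h (X i \<omega>) - integral\<^sup>L \<mu> h) / sqrt n)"
    by (simp only: V_def)
  have "(\<Sum>i<n. expectation (\<lambda>\<omega>. (V i \<omega>)\<^sup>2)) / n \<le> (\<Sum>i<n. LINT t|\<mu>. (h t)\<^sup>2) / n"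
    by (intro divide_right_mono sum_mono EV2) auto
  \<comment> \<open>For \<open>n = 0\<close> the empty sum leaves 0 on the left; otherwise equality
    holds.\<close>
  also have "\<dots> \<le> (LINT t|\<mu>. (h t)\<^sup>2)" by (cases "n = 0") auto
  finally have "expectation (\<lambda>\<omega>. (?S \<omega>)\<^sup>2) \<le> (LINT t|\<mu>. (h t)\<^sup>2)" unfolding S2(2) .
  moreover have "expectation (\<lambda>\<omega>. \<bar>?S \<omega>\<bar>) \<le> sqrt (expectation (\<lambda>\<omega>. (?S \<omega>)\<^sup>2))"
    by (rule expectation_abs_le_sqrt[OF _ S2(1)]) simp
  ultimately have "expectation (\<lambda>\<omega>. \<bar>?S \<omega>\<bar>) \<le> sqrt (LINT t|\<mu>. (h t)\<^sup>2)"
    by (auto intro: order_trans)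
  then show "expectation (\<lambda>\<omega>. \<bar>(\<Sum>i<n. h (X i \<omega>) - integral\<^sup>L \<mu> h) / sqrt n\<bar>) \<le> sqrt (LINT t|\<mu>. (h t)\<^sup>2)"
    by (simp only: V_def)
qed

section \<open>The central limit theorem for the estimator\<close>

text \<open>The centering \<open>a n\<close> is left free, and \<open>c\<close> is the limit of the
  scaled gap between it and the mean of the kernel. Centering at the expectation and at the c.d.f.
  are then instances of a single statement.\<close>

lemma (in prob_space) F_hat_Gam_weak_conv:
  assumes X: "indep_vars (\<lambda>_. borel) X UNIV" and D: "\<And>i. distr M borel (X i) = \<mu>"
    and F: "smooth_cdf_on_half_line (cdf \<mu>) f f'"
    and b: "\<And>n. b n > 0" "b \<longlonglongrightarrow> 0" and x: "x > 0" and Fx: "0 < cdf \<mu> x" "cdf \<mu> x < 1"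
    and center: "(\<lambda>n. sqrt n * ((LINT t|\<mu>. K_Gam_bar t (x / b n + 1) (b n)) - a n)) \<longlonglongrightarrow> c"
  shows "weak_conv_m (\<lambda>n. distr M borel (\<lambda>\<omega>. sqrt n * (F_hat_Gam X n (b n) x \<omega> - a n)))
    (normal_law c (cdf \<mu> x * (1 - cdf \<mu> x)))"
proof -
  have [measurable]: "random_variable borel (X i)" for i using X unfolding indep_vars_def2 by simp
  interpret \<mu>: real_distribution \<mu>
    by (subst D[symmetric, of 0], rule real_distribution_distr) simp
  define v where "v = cdf \<mu> x * (1 - cdf \<mu> x)"
  have v: "v > 0" using Fx by (simp add: v_def)
  have neg: "\<forall>y<0. cdf \<mu> y = 0" using F by (simp add: smooth_cdf_on_half_line_def)
  \<comment> \<open>Differentiability at \<open>x > 0\<close> makes the c.d.f. continuous there,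
    which means that \<open>{x}\<close> carries no mass.\<close>
  have atom: "\<mu>.prob {x} = 0"
    using F x unfolding smooth_cdf_on_half_line_def \<mu>.isCont_cdf[symmetric] by (blast intro: DERIV_isCont)
  have \<alpha>: "x / b n + 1 > 0" for n using b(1)[of n] x by (auto intro: add_nonneg_pos)
  define K where "K n t = K_Gam_bar t (x / b n + 1) (b n)" for n t
  define I where "I t = (of_bool (t \<le> x) :: real)" for t
  have [measurable]: "K n \<in> borel_measurable borel" for n unfolding K_def by measurable
  have [measurable]: "I \<in> borel_measurable borel" unfolding I_def of_bool_def by measurable
  have K01: "AE t in \<mu>. 0 \<le> K n t \<and> K n t \<le> 1" for n
    using \<mu>.AE_nonneg_if_cdf_neg_0[OF neg] unfolding K_def
    by eventually_elim (simp add: K_Gam_bar_nonneg K_Gam_bar_le_1 \<alpha> b)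
  have intK: "integrable \<mu> (K n)" for n
    by (rule \<mu>.integrable_const_bound[of _ 1]) (use K01[of n] in auto)
  have intI: "integrable \<mu> I" by (rule \<mu>.integrable_const_bound[of _ 1]) (auto simp: I_def)
  have EI: "integral\<^sup>L \<mu> I = cdf \<mu> x"
  proof -
    have "I = indicator {..x}" by (simp add: fun_eq_iff I_def indicator_def)
    then show ?thesis by (simp add: cdf_def)
  qed
  define h where "h n t = K n t - I t" for n t
  have [measurable]: "h n \<in> borel_measurable borel" for n unfolding h_def by measurable
  have Eh: "integral\<^sup>L \<mu> (h n) = integral\<^sup>L \<mu> (K n) - cdf \<mu> x" for n
    unfolding h_def using intK[of n] intI EI by simp
  have hsq: "integrable \<mu> (\<lambda>t. (h n t)\<^sup>2)" for n
  proof (rule \<mu>.integrable_const_bound[of _ 1])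
    show "AE t in \<mu>. norm ((h n t)\<^sup>2) \<le> 1"
      using K01[of n] by eventually_elim (auto simp: h_def I_def abs_square_le_1)
  qed simp
  \<comment> \<open>The standardized empirical c.d.f. at \<open>x\<close>, with the denominator
    written as in the classical central limit theorem.\<close>
  define Y where "Y n \<omega> = (\<Sum>i<n. I (X i \<omega>) - cdf \<mu> x) / sqrt (n * (sqrt v)\<^sup>2)" for n \<omega>
  define W where "W n \<omega> = sqrt n * (F_hat_Gam X n (b n) x \<omega> - a n)" for n \<omega>
  have [measurable]: "random_variable borel (Y n)" for n unfolding Y_def by measurable
  have [measurable]: "random_variable borel (W n)" for n unfolding W_def F_hat_Gam_def by measurable
  have clt: "weak_conv_m (\<lambda>n. distr M borel (Y n)) std_normal_distribution"
    unfolding Y_def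
  proof (rule central_limit_theorem)
    have II: "I t ^ 2 = I t" for t by (simp add: I_def)
    have iIX: "integrable M (\<lambda>\<omega>. I (X i \<omega>))" for i
      by (rule integrable_const_bound[of _ 1]) (auto simp: I_def)
    show "indep_vars (\<lambda>_. borel) (\<lambda>i \<omega>. I (X i \<omega>)) UNIV"
      by (rule indep_vars_compose2[OF X]) auto
    show E: "expectation (\<lambda>\<omega>. I (X i \<omega>)) = cdf \<mu> x" for i
      using integral_distr[of "X i" M borel I] EI by (simp add: D)
    show "sqrt v > 0" using v by simp
    show sq: "integrable M (\<lambda>\<omega>. (I (X i \<omega>))\<^sup>2)" for i unfolding II by (rule iIX)
    have E2: "expectation (\<lambda>\<omega>. (I (X i \<omega>))\<^sup>2) = cdf \<mu> x" for i unfolding II by (rule E)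
    have "(sqrt v)\<^sup>2 = cdf \<mu> x - (cdf \<mu> x)\<^sup>2"
      using v by (simp add: v_def power2_eq_square algebra_simps)
    then show "variance (\<lambda>\<omega>. I (X i \<omega>)) = (sqrt v)\<^sup>2" for i
      using variance_eq[OF iIX[of i] sq[of i]] by (simp only: E E2)
    show "distr M borel (\<lambda>\<omega>. I (X i \<omega>)) = distr \<mu> borel I" for i
      unfolding D[of i, symmetric] by (subst distr_distr) (auto simp: comp_def)
  qed
  \<comment> \<open>\<open>S\<close> is the random part of the discrepancy between estimator and
    empirical c.d.f.; \<open>r\<close> is the deterministic part, the error of the scaled
    bias.\<close>
  define S where "S n \<omega> = (\<Sum>i<n. h n (X i \<omega>) - integral\<^sup>L \<mu> (h n)) / sqrt n" for n \<omega>
  define r where "r n = sqrt n * (integral\<^sup>L \<mu> (K n) - a n) - c" for n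
  have S: "integrable M (\<lambda>\<omega>. S n \<omega>)"
    "expectation (\<lambda>\<omega>. \<bar>S n \<omega>\<bar>) \<le> sqrt (LINT t|\<mu>. (h n t)\<^sup>2)" for n
    unfolding S_def by (intro iid_normalized_sum_abs_le X D hsq; measurable)+
  \<comment> \<open>For \<open>n = 0\<close> both sides are \<open>- c\<close>.\<close>
  have decomp: "W n \<omega> - (c + sqrt v * Y n \<omega>) = S n \<omega> + r n" for n \<omega>
  proof (cases "n = 0")
    case False
    \<comment> \<open>Trading \<open>sqrt n\<close> for \<open>n / sqrt n\<close> puts all terms
      over the common denominator \<open>sqrt n\<close>.\<close>
    have sn: "sqrt n * z = real n * z / sqrt n" for z
      using False by (simp add: field_simps flip: real_sqrt_mult)
    have "W n \<omega> = ((\<Sum>i<n. K n (X i \<omega>)) - real n * a n) / sqrt n"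
      using False unfolding W_def F_hat_Gam_def sn K_def by (simp add: algebra_simps)
    moreover have "sqrt v * Y n \<omega> = ((\<Sum>i<n. I (X i \<omega>)) - real n * cdf \<mu> x) / sqrt n"
      using v unfolding Y_def by (simp add: real_sqrt_mult sum_subtractf)
    moreover have "S n \<omega> = ((\<Sum>i<n. K n (X i \<omega>)) - (\<Sum>i<n. I (X i \<omega>))
        - real n * (integral\<^sup>L \<mu> (K n) - cdf \<mu> x)) / sqrt n"
      unfolding S_def Eh by (simp add: h_def sum_subtractf)
    moreover have "r n = real n * (integral\<^sup>L \<mu> (K n) - a n) / sqrt n - c"
      unfolding r_def sn ..
    ultimately show ?thesis
      by (simp add: diff_divide_distrib right_diff_distrib)
  qed (simp add: W_def Y_def S_def r_def)
  have r: "r \<longlonglongrightarrow> 0"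
    using tendsto_diff[OF center tendsto_const[of c]] unfolding r_def K_def by simp
  have "weak_conv_m (\<lambda>n. distr M borel (W n)) (distr std_normal_distribution borel (\<lambda>y. c + sqrt v * y))"
  proof (rule weak_conv_m_affine_approx[OF _ _ real_dist_normal_dist clt])
    show "integrable M (\<lambda>\<omega>. W n \<omega> - (c + sqrt v * Y n \<omega>))" for n
      unfolding decomp using S(1)[of n] by simp
    have "(\<lambda>n. sqrt (LINT t|\<mu>. (h n t)\<^sup>2) + \<bar>r n\<bar>) \<longlonglongrightarrow> sqrt 0 + \<bar>0\<bar>"
      using \<mu>.K_Gam_bar_L2_tendsto[OF neg less_imp_le[OF x] atom b]
      unfolding h_def K_def I_def by (intro tendsto_intros r)
    then have lim: "(\<lambda>n. sqrt (LINT t|\<mu>. (h n t)\<^sup>2) + \<bar>r n\<bar>) \<longlonglongrightarrow> 0" by simp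
    show "(\<lambda>n. expectation (\<lambda>\<omega>. \<bar>W n \<omega> - (c + sqrt v * Y n \<omega>)\<bar>)) \<longlonglongrightarrow> 0"
    proof (rule Lim_null_comparison[OF always_eventually[OF allI] lim])
      fix n
      have "expectation (\<lambda>\<omega>. \<bar>S n \<omega> + r n\<bar>) \<le> expectation (\<lambda>\<omega>. \<bar>S n \<omega>\<bar> + \<bar>r n\<bar>)"
        using S(1)[of n] by (intro integral_mono) auto
      also have "\<dots> = expectation (\<lambda>\<omega>. \<bar>S n \<omega>\<bar>) + \<bar>r n\<bar>"
        using S(1)[of n] by (simp add: prob_space)
      also have "\<dots> \<le> sqrt (LINT t|\<mu>. (h n t)\<^sup>2) + \<bar>r n\<bar>"
        using S(2)[of n] by simp
      finally show "norm (expectation (\<lambda>\<omega>. \<bar>W n \<omega> - (c + sqrt v * Y n \<omega>)\<bar>))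
          \<le> sqrt (LINT t|\<mu>. (h n t)\<^sup>2) + \<bar>r n\<bar>"
        unfolding decomp by simp
    qed
  qed auto
  then show ?thesis
    unfolding distr_affine_std_normal[OF v] unfolding W_def v_def .
qed

theorem proposition4p4:
  fixes M :: "'a measure"
    and X :: "nat \<Rightarrow> 'a \<Rightarrow> real"
    and F f f' :: "real \<Rightarrow> real"
    and b :: "nat \<Rightarrow> real"
    and x :: real
  assumes "prob_space M"
    and "prob_space.indep_vars M (\<lambda>_. borel) X UNIV"
    and "\<And>i. cdf (distr M borel (X i)) = F"
    and "smooth_cdf_on_half_line F f f'"
    and "\<And>n. b n > 0"
    and "b \<longlonglongrightarrow> 0"
    and "x > 0"
    and "0 < F x" and "F x < 1"
  shows "weak_conv_m
           (\<lambda>n. distr M borel (\<lambda>\<omega>. sqrt (real n) *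
              (F_hat_Gam X n (b n) x \<omega> - prob_space.expectation M (F_hat_Gam X n (b n) x))))
           (normal_law 0 (F x * (1 - F x)))
       \<and> ((\<lambda>n. sqrt (real n) * b n) \<longlonglongrightarrow> 0 \<longrightarrow>
          weak_conv_m
            (\<lambda>n. distr M borel (\<lambda>\<omega>. sqrt (real n) * (F_hat_Gam X n (b n) x \<omega> - F x)))
            (normal_law 0 (F x * (1 - F x))))
       \<and> (\<forall>c>0. (\<lambda>n. sqrt (real n) * b n) \<longlonglongrightarrow> c \<longrightarrow>
          weak_conv_m
            (\<lambda>n. distr M borel (\<lambda>\<omega>. sqrt (real n) * (F_hat_Gam X n (b n) x \<omega> - F x)))
            (normal_law (c * (f x + x / 2 * f' x)) (F x * (1 - F x))))"
proof -
  interpret prob_space M by fact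
  have rv: "random_variable borel (X i)" for i using assms(2) unfolding indep_vars_def2 by simp
  define \<mu> where "\<mu> = distr M borel (X 0)"
  have D: "distr M borel (X i) = \<mu>" for i
    \<comment> \<open>All observations share one c.d.f., which determines the law.\<close>
    unfolding \<mu>_def using assms(3) rv by (intro cdf_unique real_distribution_distr) auto
  interpret \<mu>: real_distribution \<mu>
    unfolding \<mu>_def by (rule real_distribution_distr[OF rv])
  have F: "F = cdf \<mu>" using assms(3) D by metis
  note smooth = assms(4)[unfolded F]
  have neg: "\<forall>y<0. cdf \<mu> y = 0" using smooth by (simp add: smooth_cdf_on_half_line_def)
  have \<alpha>: "x / b n + 1 > 0" for n using assms(5)[of n] assms(7) by (auto intro: add_nonneg_pos)
  let ?K = "\<lambda>n t. K_Gam_bar t (x / b n + 1) (b n)"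
  note conv = F_hat_Gam_weak_conv[OF assms(2) D smooth assms(5,6,7) assms(8,9)[unfolded F]]
  \<comment> \<open>At \<open>n = 0\<close> the estimator is 0 by the convention for division by 0,
    so its mean need not be that of the kernel; the factor \<open>sqrt n\<close> hides this case
    later.\<close>
  have mean: "expectation (F_hat_Gam X n (b n) x) = integral\<^sup>L \<mu> (?K n)" if "n > 0" for n
  proof -
    have "AE t in \<mu>. norm (?K n t) \<le> 1"
      using \<mu>.AE_nonneg_if_cdf_neg_0[OF neg]
      by eventually_elim (simp add: K_Gam_bar_nonneg K_Gam_bar_le_1 \<alpha> assms(5))
    then have "integrable \<mu> (?K n)" by (intro \<mu>.integrable_const_bound[of _ 1]) auto
    then have iK: "integrable M (\<lambda>\<omega>. ?K n (X i \<omega>))" for i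
      unfolding D[of i, symmetric] by (subst (asm) integrable_distr_eq) (use rv in auto)
    have EK: "expectation (\<lambda>\<omega>. ?K n (X i \<omega>)) = integral\<^sup>L \<mu> (?K n)" for i
      unfolding D[of i, symmetric] by (subst integral_distr) (use rv in auto)
    show ?thesis unfolding F_hat_Gam_def using iK EK that by simp
  qed
  \<comment> \<open>The scaled bias is \<open>sqrt n * b n\<close> times the bias per unit of
    \<open>b n\<close>. The limits \<open>l = 0\<close> and \<open>l = c\<close> give the two
    statements centered at \<open>F x\<close>.\<close>
  have bias: "(\<lambda>n. sqrt n * (integral\<^sup>L \<mu> (?K n) - F x)) \<longlonglongrightarrow> l * (f x + x / 2 * f' x)"
    if l: "(\<lambda>n. sqrt n * b n) \<longlonglongrightarrow> l" for l
  proof -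
    have "(\<lambda>n. (sqrt n * b n) * ((integral\<^sup>L \<mu> (?K n) - F x) / b n)) \<longlonglongrightarrow> l * (f x + x / 2 * f' x)"
      using \<mu>.gamma_smoothing_bias[OF smooth assms(7,5,6)]
      unfolding \<mu>.integral_K_Gam_bar[OF neg \<alpha> assms(5)] F by (intro tendsto_mult l)
    moreover have "b n \<noteq> 0" for n using assms(5)[of n] by simp
    ultimately show ?thesis by simp
  qed
  show ?thesis
  proof (intro conjI allI impI)
    have 0: "sqrt n * (integral\<^sup>L \<mu> (?K n) - expectation (F_hat_Gam X n (b n) x)) = 0" for n
      using mean[of n] by (cases "n = 0") auto
    show "weak_conv_m
           (\<lambda>n. distr M borel (\<lambda>\<omega>. sqrt (real n) *
              (F_hat_Gam X n (b n) x \<omega> - expectation (F_hat_Gam X n (b n) x))))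
           (normal_law 0 (F x * (1 - F x)))"
      unfolding F by (rule conv) (simp only: 0 tendsto_const)
  next
    assume "(\<lambda>n. sqrt (real n) * b n) \<longlonglongrightarrow> 0"
    from bias[OF this] show "weak_conv_m
            (\<lambda>n. distr M borel (\<lambda>\<omega>. sqrt (real n) * (F_hat_Gam X n (b n) x \<omega> - F x)))
            (normal_law 0 (F x * (1 - F x)))"
      unfolding F by (intro conv) simp
  next
    fix c :: real assume "(\<lambda>n. sqrt (real n) * b n) \<longlonglongrightarrow> c"
    from bias[OF this] show "weak_conv_m
            (\<lambda>n. distr M borel (\<lambda>\<omega>. sqrt (real n) * (F_hat_Gam X n (b n) x \<omega> - F x)))
            (normal_law (c * (f x + x / 2 * f' x)) (F x * (1 - F x)))"
      unfolding F by (rule conv)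
  qed
qed

end
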